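(* Let $\alpha:I\subset\mathbb R\to E^n$ be a unit speed curve in the Euclidean space $E^n$ with curvatures $\kappa_1,\ldots,\kappa_{n-1}$, satisfying $\kappa_i(s)\neq 0$ for all $s\in I$ and $1\le i\le n-1$. Define $$G_1=\int\kappa_1(s)\,ds,\qquad G_2=1,\qquad G_3=\frac{\kappa_1}{\kappa_2}G_1,\qquad G_i=\frac{1}{\kappa_{i-1}}\Big[\kappa_{i-2}G_{i-2}+G_{i-1}'\Big]\quad (4\le i\le n-1),$$ and let $\phi(s)=\int^s\kappa_{n-1}(u)\,du$. Then $\alpha$ is a slant helix if and only if (for some choice of the antiderivative $G_1$ of $\kappa_1$) the following condition is satisfied for some constants $A$ and $B$: for all $s\in I$, $$G_{n-1}(s)=\Big(A-\int\kappa_{n-2}G_{n-2}\sin\phi\,ds\Big)\sin\phi(s)-\Big(B+\int\kappa_{n-2}G_{n-2}\cos\phi\,ds\Big)\cos\phi(s).$$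
   Context: $E^n$ is $\mathbb R^n$ with the standard scalar product $\langle X,Y\rangle=\sum_{i=1}^n x_iy_i$; here $n\ge 3$, and $I\subset\mathbb R$ is an open interval. Curves and curvature functions are assumed differentiable as often as needed (smooth). A curve $\alpha$ is of unit speed if $\langle\alpha'(s),\alpha'(s)\rangle=1$ for all $s\in I$. Primes denote $d/ds$. Frenet frame: $\{V_1(s),\ldots,V_n(s)\}$ is the orthonormal moving frame along $\alpha$ with $V_1=\alpha'$ satisfying the Frenet equations $$V_1'=\kappa_1V_2,\qquad V_i'=-\kappa_{i-1}V_{i-1}+\kappa_iV_{i+1}\ (2\le i\le n-1),\qquad V_n'=-\kappa_{n-1}V_{n-1}.$$ The function $\kappa_i(s)$ is the $i$-th curvature of $\alpha$, and $V_2$ is the unit principal normal. Slant helix: a unit speed curve $\alpha:I\to E^n$ is called a slant helix if its unit principal normal $V_2$ makes a constant angle $\theta$ with a fixed direction $U$, i.e. there is a constant vector $U$ with $\langle U,U\rangle=1$ such that $\langle V_2(s),U\rangle=\cos\theta$ for all $s\in I$, with $\theta$ constant. Integrals without limits denote indefinite integrals (antiderivatives) on $I$; $\phi$ is a fixed antiderivative of $\kappa_{n-1}$ on $I$, and the antiderivatives of $\kappa_{n-2}G_{n-2}\sin\phi$ and $\kappa_{n-2}G_{n-2}\cos\phi$ are fixed arbitrarily (their integration constants can be absorbed in $A$ and $B$).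
   Formalization: The slant helix angle is required to satisfy cos θ ≠ 0; with θ = π/2 allowed the claim is false: a circular helix in E^3 has V_2 orthogonal to its axis but violates the integral condition for every choice of G_1, A and B. *)

theory Defs
  imports "HOL-Analysis.Analysis"
begin

definition smooth_on :: "real set \<Rightarrow> (real \<Rightarrow> 'a::real_normed_vector) \<Rightarrow> bool" where
  "smooth_on I f \<longleftrightarrow>
     (\<forall>k. ((\<lambda>g s. vector_derivative g (at s)) ^^ k) f differentiable_on I)"

definition antiderivative_on :: "real set \<Rightarrow> (real \<Rightarrow> real) \<Rightarrow> (real \<Rightarrow> real) \<Rightarrow> bool" where
  "antiderivative_on I F f \<longleftrightarrow> (\<forall>s\<in>I. (F has_real_derivative f s) (at s))"

definition unit_speed_on :: "real set \<Rightarrow> (real \<Rightarrow> real ^ 'n) \<Rightarrow> bool" where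
  "unit_speed_on I \<alpha> \<longleftrightarrow>
     smooth_on I \<alpha> \<and>
     (\<forall>s\<in>I. vector_derivative \<alpha> (at s) \<bullet> vector_derivative \<alpha> (at s) = 1)"

text \<open>
  The dimension is \<open>n = CARD('n)\<close>. Only the frame vectors \<open>V 1, \<dots>, V n\<close> and the curvatures
  \<open>\<kappa> 1, \<dots>, \<kappa> (n - 1)\<close> are meaningful; other indices are unconstrained.
\<close>

definition frenet_frame ::
  "real set \<Rightarrow> (real \<Rightarrow> real ^ 'n) \<Rightarrow> (nat \<Rightarrow> real \<Rightarrow> real ^ 'n) \<Rightarrow> (nat \<Rightarrow> real \<Rightarrow> real) \<Rightarrow> bool"
where
  "frenet_frame I \<alpha> V \<kappa> \<longleftrightarrow>
     (\<forall>s\<in>I.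
        (\<forall>i\<in>{1..CARD('n)}. \<forall>j\<in>{1..CARD('n)}. V i s \<bullet> V j s = (if i = j then 1 else 0)) \<and>
        V 1 s = vector_derivative \<alpha> (at s) \<and>
        (V 1 has_vector_derivative \<kappa> 1 s *\<^sub>R V 2 s) (at s) \<and>
        (\<forall>i\<in>{2..CARD('n) - 1}.
           (V i has_vector_derivative
              (- \<kappa> (i - 1) s) *\<^sub>R V (i - 1) s + \<kappa> i s *\<^sub>R V (i + 1) s) (at s)) \<and>
        (V (CARD('n)) has_vector_derivative
           (- \<kappa> (CARD('n) - 1) s) *\<^sub>R V (CARD('n) - 1) s) (at s))"

text \<open>
  The angle \<open>\<theta>\<close> is a parameter because right angles have to be excluded from the characterization:
  the functions \<open>G\<^sub>i\<close> below are the frame components of the axis \<open>U\<close> divided by \<open>cos \<theta>\<close> (whence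
  \<open>G\<^sub>2 = 1\<close>). A circular helix in three-space has its principal normal orthogonal to a fixed
  direction, but violates the integral condition for every choice of \<open>G\<^sub>1\<close>, \<open>A\<close> and \<open>B\<close>.
\<close>

definition slant_helix ::
  "real set \<Rightarrow> (real \<Rightarrow> real ^ 'n) \<Rightarrow> (nat \<Rightarrow> real \<Rightarrow> real ^ 'n) \<Rightarrow> real \<Rightarrow> bool" where
  "slant_helix I \<alpha> V \<theta> \<longleftrightarrow>
     unit_speed_on I \<alpha> \<and> (\<exists>U. U \<bullet> U = 1 \<and> (\<forall>s\<in>I. V 2 s \<bullet> U = cos \<theta>))"

text \<open>
  \<open>slant_G \<kappa> g i\<close> is \<open>G\<^sub>i\<close>, where \<open>g\<close> is the chosen antiderivative \<open>G\<^sub>1\<close> of \<open>\<kappa>\<^sub>1\<close>.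
  The last equation is the recursion for \<open>i = k + 4\<close>; the value at index 0 is a dummy.
\<close>

fun slant_G :: "(nat \<Rightarrow> real \<Rightarrow> real) \<Rightarrow> (real \<Rightarrow> real) \<Rightarrow> nat \<Rightarrow> real \<Rightarrow> real" where
  "slant_G \<kappa> g 0 = (\<lambda>s. 0)"
| "slant_G \<kappa> g (Suc 0) = g"
| "slant_G \<kappa> g (Suc (Suc 0)) = (\<lambda>s. 1)"
| "slant_G \<kappa> g (Suc (Suc (Suc 0))) = (\<lambda>s. \<kappa> 1 s / \<kappa> 2 s * g s)"
| "slant_G \<kappa> g (Suc (Suc (Suc (Suc k)))) =
     (\<lambda>s. 1 / \<kappa> (k + 3) s *
        (\<kappa> (k + 2) s * slant_G \<kappa> g (k + 2) s + deriv (slant_G \<kappa> g (k + 3)) s))"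

end

theory Submission
  imports Defs
begin

text \<open>
  For a constant vector \<open>U\<close>, the Frenet equations say that the components of \<open>U\<close> in the frame solve
  the same skew-symmetric tridiagonal linear system as the frame itself. If the second component
  is normalized to 1, the equations of index up to \<open>n - 2\<close> determine the components successively,
  and these are the \<open>G\<^sub>i\<close>. The last two equations form a planar system that rotates with angular
  velocity \<open>\<phi>'\<close>; variation of constants turns it into the integral condition. Conversely, any
  solution of the system supplies the components of a vector whose derivative vanishes, because
  that derivative is a telescoping sum.
\<close>

section \<open>Differentiability of finite order on an open set\<close>

text \<open>The derivative is an existential witness, so closure proofs can supply it as a formula,
  and only its values on \<open>I\<close> matter. Such facts are needed because
  \<open>slant_G\<close> is built with \<open>deriv\<close>, which is informative only where
  differentiability is known.\<close>

fun diff_times :: "nat \<Rightarrow> real set \<Rightarrow> (real \<Rightarrow> real) \<Rightarrow> bool" where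
  "diff_times 0 I f = True"
| "diff_times (Suc k) I f =
     (\<exists>f'. (\<forall>s\<in>I. (f has_real_derivative f' s) (at s)) \<and> diff_times k I f')"

lemma diff_times_Suc_imp: "diff_times (Suc k) I f \<Longrightarrow> diff_times k I f"
proof (induction k arbitrary: f)
  case (Suc k)
  then obtain f' where f': "\<forall>s\<in>I. (f has_real_derivative f' s) (at s)" "diff_times (Suc k) I f'"
    by (auto simp del: diff_times.simps(2) simp: diff_times.simps(2)[of "Suc k"])
  with Suc.IH have "diff_times k I f'" by blast
  with f'(1) show ?case by auto
qed simp

text \<open>A derivative at a point of an open set does not see values outside the set. This allows
  a witness \<open>f'\<close> to be exchanged for \<open>deriv f\<close> later.\<close>

lemma diff_times_cong:
  assumes "open I" "\<And>s. s \<in> I \<Longrightarrow> f s = g s" "diff_times k I f"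
  shows "diff_times k I g"
proof (cases k)
  case (Suc m)
  then obtain f' where f': "\<forall>s\<in>I. (f has_real_derivative f' s) (at s)" "diff_times m I f'"
    using assms(3) by auto
  have "\<forall>s\<in>I. (g has_real_derivative f' s) (at s)"
    using f'(1) assms(1,2) by (metis has_field_derivative_transform_within_open)
  with f'(2) Suc show ?thesis by auto
qed simp

lemma diff_times_const: "diff_times k I (\<lambda>s. c)"
proof (induction k arbitrary: c)
  case (Suc k)
  then show ?case by (auto intro!: exI[of _ "\<lambda>s. 0"])
qed simp

lemma diff_times_add:
  "diff_times k I f \<Longrightarrow> diff_times k I g \<Longrightarrow> diff_times k I (\<lambda>s. f s + g s)"
proof (induction k arbitrary: f g)
  case (Suc k)
  then obtain f' g' where "\<forall>s\<in>I. (f has_real_derivative f' s) (at s)" "diff_times k I f'"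
    "\<forall>s\<in>I. (g has_real_derivative g' s) (at s)" "diff_times k I g'"
    by auto
  then have "\<forall>s\<in>I. ((\<lambda>s. f s + g s) has_real_derivative f' s + g' s) (at s)"
    "diff_times k I (\<lambda>s. f' s + g' s)"
    using Suc.IH by (auto intro: DERIV_add)
  then show ?case by auto
qed simp

lemma diff_times_mult:
  "diff_times k I f \<Longrightarrow> diff_times k I g \<Longrightarrow> diff_times k I (\<lambda>s. f s * g s)"
proof (induction k arbitrary: f g)
  case (Suc k)
  \<comment> \<open>The product rule contains \<open>f\<close> and \<open>g\<close>
    undifferentiated, so both are also needed with the lower order.\<close>
  then have fg: "diff_times k I f" "diff_times k I g"
    by (blast intro: diff_times_Suc_imp)+
  from Suc.prems obtain f' g' where
    "\<forall>s\<in>I. (f has_real_derivative f' s) (at s)" "diff_times k I f'"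
    "\<forall>s\<in>I. (g has_real_derivative g' s) (at s)" "diff_times k I g'"
    by auto
  with fg have "\<forall>s\<in>I. ((\<lambda>s. f s * g s) has_real_derivative f' s * g s + g' s * f s) (at s)"
    "diff_times k I (\<lambda>s. f' s * g s + g' s * f s)"
    by (auto intro!: DERIV_mult diff_times_add Suc.IH)
  then show ?case by auto
qed simp

lemma diff_times_inverse:
  "diff_times k I f \<Longrightarrow> (\<And>s. s \<in> I \<Longrightarrow> f s \<noteq> 0) \<Longrightarrow> diff_times k I (\<lambda>s. inverse (f s))"
proof (induction k)
  case (Suc k)
  then have "diff_times k I (\<lambda>s. inverse (f s))"
    by (blast intro: diff_times_Suc_imp)
  moreover from Suc.prems obtain f' where
    f': "\<forall>s\<in>I. (f has_real_derivative f' s) (at s)" and "diff_times k I f'"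
    by auto
  \<comment> \<open>This is the derivative of the reciprocal, written as a product so that closure
    under products applies; the reciprocal itself enters only with order \<open>k\<close>, known by
    induction.\<close>
  ultimately have "diff_times k I (\<lambda>s. (- 1) * (inverse (f s) * (f' s * inverse (f s))))"
    by (intro diff_times_mult diff_times_const)
  moreover have "((\<lambda>s. inverse (f s)) has_real_derivative
      (- 1) * (inverse (f s) * (f' s * inverse (f s)))) (at s)" if "s \<in> I" for s
    using DERIV_inverse_fun[of f "f' s" s UNIV] f' Suc.prems(2) that by (simp add: ac_simps)
  ultimately show ?case
    unfolding diff_times.simps by (intro exI conjI ballI)
qed simp

lemma diff_times_deriv:
  assumes "open I" "diff_times (Suc k) I f"
  shows "diff_times k I (deriv f)"
proof -
  obtain f' where f': "\<forall>s\<in>I. (f has_real_derivative f' s) (at s)" "diff_times k I f'"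
    using assms(2) by auto
  then have "\<And>s. s \<in> I \<Longrightarrow> f' s = deriv f s"
    using DERIV_imp_deriv by metis
  then show ?thesis using diff_times_cong[OF assms(1)] f'(2) by blast
qed

lemma smooth_on_imp_diff_times:
  "open I \<Longrightarrow> smooth_on I f \<Longrightarrow> diff_times k I f"
proof (induction k arbitrary: f)
  case (Suc k)
  let ?D = "\<lambda>g s. vector_derivative g (at s)"
  have sm: "((?D ^^ j) f) differentiable_on I" for j
    using Suc.prems(2) by (simp add: smooth_on_def)
  have "\<forall>s\<in>I. (f has_real_derivative ?D f s) (at s)"
  proof
    fix s assume "s \<in> I"
    then have "f differentiable at s"
      using sm[of 0] Suc.prems(1) by (simp add: differentiable_on_eq_differentiable_at)
    then show "(f has_real_derivative ?D f s) (at s)"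
      by (simp add: vector_derivative_works has_real_derivative_iff_has_vector_derivative)
  qed
  moreover have "smooth_on I (?D f)"
    unfolding smooth_on_def
  proof
    fix j
    show "((?D ^^ j) (?D f)) differentiable_on I"
      using sm[of "Suc j"] by (simp only: funpow_Suc_right o_apply)
  qed
  ultimately show ?case using Suc by auto
qed simp

section \<open>The functions \<open>slant_G\<close> as successive solutions of the component
  equations\<close>

text \<open>Each step of the recursion costs one derivative, so the data are assumed differentiable
  to every order and \<open>k\<close> stays arbitrary in the induction. Only curvatures of index
  below \<open>i\<close> occur, also as divisors.\<close>

lemma diff_times_slant_G:
  assumes "open I"
    and \<kappa>: "\<And>j k. j \<in> {1..<i} \<Longrightarrow> diff_times k I (\<kappa> j)"
    and nz: "\<And>j s. j \<in> {1..<i} \<Longrightarrow> s \<in> I \<Longrightarrow> \<kappa> j s \<noteq> 0"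
    and g: "\<And>k. diff_times k I g"
  shows "diff_times k I (slant_G \<kappa> g i)"
  using \<kappa> nz
proof (induction \<kappa> g \<equiv> g i arbitrary: k rule: slant_G.induct)
  case (4 \<kappa>)
  then show ?case
    by (auto simp: divide_inverse intro!: diff_times_mult diff_times_inverse g)
next
  case (5 \<kappa> m)
  have "diff_times k I (deriv (slant_G \<kappa> g (m + 3)))"
    by (intro diff_times_deriv assms(1) 5) (use 5 in auto)
  moreover have "diff_times k I (slant_G \<kappa> g (m + 2))"
    by (intro 5) (use 5 in auto)
  ultimately show ?case using 5
    by (auto simp: divide_inverse intro!: diff_times_mult diff_times_add diff_times_inverse)
qed (auto simp: g diff_times_const)

lemma slant_G_Suc:
  assumes "i \<ge> 3"
  shows "slant_G \<kappa> g (Suc i) s =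
    1 / \<kappa> i s * (\<kappa> (i - 1) s * slant_G \<kappa> g (i - 1) s + deriv (slant_G \<kappa> g i) s)"
proof -
  from assms obtain k where "i = k + 3" using le_Suc_ex by (metis add.commute)
  then show ?thesis by (simp add: numeral_eq_Suc)
qed

text \<open>The recursion is the component equation of index \<open>i\<close> solved for the
  component of index \<open>Suc i\<close>. For \<open>i = 2\<close> the left side is the derivative
  of the constant 1, and the equation reduces to the definition of the third function.\<close>

lemma slant_G_has_derivative:
  assumes "i \<ge> 2" "\<kappa> i s \<noteq> 0"
    and "(slant_G \<kappa> g i has_real_derivative D) (at s)"
  shows "(slant_G \<kappa> g i has_real_derivative
    - \<kappa> (i - 1) s * slant_G \<kappa> g (i - 1) s + \<kappa> i s * slant_G \<kappa> g (Suc i) s) (at s)"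
proof (cases "i = 2")
  case True
  then show ?thesis using assms(2) by (simp add: numeral_2_eq_2)
next
  case False
  then have "slant_G \<kappa> g (Suc i) s =
      1 / \<kappa> i s * (\<kappa> (i - 1) s * slant_G \<kappa> g (i - 1) s + D)"
    using assms by (simp add: slant_G_Suc DERIV_imp_deriv)
  then have "- \<kappa> (i - 1) s * slant_G \<kappa> g (i - 1) s + \<kappa> i s * slant_G \<kappa> g (Suc i) s = D"
    using assms(2) by simp
  then show ?thesis using assms(3) by simp
qed

text \<open>Starting from \<open>a 1\<close> and the constant \<open>a 2\<close>, the equation of
  index \<open>j\<close> determines \<open>a (Suc j)\<close> after division by
  \<open>\<kappa> j\<close>, just as the recursion does.\<close>

lemma slant_G_unique:
  assumes "open I"
    and a2: "\<And>s. s \<in> I \<Longrightarrow> a 2 s = 1"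
    and nz: "\<And>i s. i \<in> {2..<n} \<Longrightarrow> s \<in> I \<Longrightarrow> \<kappa> i s \<noteq> 0"
    and deriv: "\<And>i s. i \<in> {2..<n} \<Longrightarrow> s \<in> I \<Longrightarrow>
      (a i has_real_derivative - \<kappa> (i - 1) s * a (i - 1) s + \<kappa> i s * a (Suc i) s) (at s)"
    and "i \<in> {1..n}" "s \<in> I"
  shows "slant_G \<kappa> (a 1) i s = a i s"
  using assms(5,6)
proof (induction i arbitrary: s rule: less_induct)
  case (less i)
  consider "i = 1" | "i = 2" | j where "i = Suc j" "j \<ge> 2"
    using less.prems by (cases i) force+
  then show ?case
  proof cases
    case 3
    then have j: "j \<in> {2..<n}" using less.prems by auto
    \<comment> \<open>Equality is needed at all points of \<open>I\<close>, not only at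
      \<open>s\<close>, so that the derivative of \<open>a j\<close> carries over to
      \<open>slant_G\<close>.\<close>
    have eq: "slant_G \<kappa> (a 1) j t = a j t" "slant_G \<kappa> (a 1) (j - 1) t = a (j - 1) t"
      if "t \<in> I" for t
      using that 3 less by auto
    have "(slant_G \<kappa> (a 1) j has_real_derivative
        - \<kappa> (j - 1) s * a (j - 1) s + \<kappa> j s * a (Suc j) s) (at s)"
      using has_field_derivative_transform_within_open[OF deriv[OF j] assms(1)] less.prems(2) eq(1)
      by metis
    \<comment> \<open>Two expressions for the same derivative differ only in the term of index
      \<open>Suc j\<close>, and its factor \<open>\<kappa> j s\<close> cancels.\<close>
    from this slant_G_has_derivative[OF 3(2) nz[OF j less.prems(2)] this] show ?thesis
      using DERIV_unique eq(2)[OF less.prems(2)] nz[OF j less.prems(2)] 3(1) by fastforce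
  qed (use less.prems a2 in \<open>auto simp: numeral_2_eq_2\<close>)
qed

section \<open>The planar system of the last two components, and recovery of the axis\<close>

text \<open>Rotating \<open>(x, y)\<close> by the angle \<open>\<phi>\<close> removes the
  \<open>\<omega>\<close> terms, leaving derivatives \<open>- f sin \<phi>\<close> and
  \<open>f cos \<phi>\<close>. Correcting by \<open>S\<close> and \<open>C\<close> gives two first
  integrals, whose values are \<open>A\<close> and \<open>B\<close>; rotating back yields
  \<open>x\<close>.\<close>

lemma rotating_system_solution:
  fixes x y f \<omega> \<phi> S C :: "real \<Rightarrow> real"
  assumes "convex I"
    and d: "\<And>s. s \<in> I \<Longrightarrow> (x has_real_derivative - f s + \<omega> s * y s) (at s)"
      "\<And>s. s \<in> I \<Longrightarrow> (y has_real_derivative - \<omega> s * x s) (at s)"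
      "\<And>s. s \<in> I \<Longrightarrow> (\<phi> has_real_derivative \<omega> s) (at s)"
      "\<And>s. s \<in> I \<Longrightarrow> (S has_real_derivative f s * sin (\<phi> s)) (at s)"
      "\<And>s. s \<in> I \<Longrightarrow> (C has_real_derivative f s * cos (\<phi> s)) (at s)"
  obtains A B where "\<And>s. s \<in> I \<Longrightarrow> x s = (A - S s) * sin (\<phi> s) - (B + C s) * cos (\<phi> s)"
proof -
  have "((\<lambda>s. x s * sin (\<phi> s) + y s * cos (\<phi> s) + S s) has_real_derivative 0) (at s)"
    and "((\<lambda>s. y s * sin (\<phi> s) - x s * cos (\<phi> s) - C s) has_real_derivative 0) (at s)"
    if "s \<in> I" for s
    by (rule derivative_eq_intros refl d that | simp add: algebra_simps)+
  note * = this[THEN has_field_derivative_at_within]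
  obtain A B
    where A: "\<And>s. s \<in> I \<Longrightarrow> x s * sin (\<phi> s) + y s * cos (\<phi> s) + S s = A"
      and B: "\<And>s. s \<in> I \<Longrightarrow> y s * sin (\<phi> s) - x s * cos (\<phi> s) - C s = B"
    using has_field_derivative_zero_constant[OF \<open>convex I\<close> *(1)]
      has_field_derivative_zero_constant[OF \<open>convex I\<close> *(2)] by blast
  show thesis
  proof
    fix s assume "s \<in> I"
    have "x s = x s * ((sin (\<phi> s))\<^sup>2 + (cos (\<phi> s))\<^sup>2)" by simp
    also have "\<dots> = (A - S s) * sin (\<phi> s) - (B + C s) * cos (\<phi> s)"
      unfolding A[OF \<open>s \<in> I\<close>, symmetric] B[OF \<open>s \<in> I\<close>, symmetric] power2_eq_square
      by algebra
    finally show "x s = (A - S s) * sin (\<phi> s) - (B + C s) * cos (\<phi> s)" .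
  qed
qed

text \<open>The vector is the sum of the \<open>H i s *\<^sub>R V i s\<close>. It is constant
  because components and frame obey the same skew-symmetric system, and orthonormality recovers its
  components.\<close>

lemma frenet_frame_axis:
  fixes V :: "nat \<Rightarrow> real \<Rightarrow> real ^ 'n"
  assumes "convex I" "CARD('n) \<ge> 3"
    and frame: "frenet_frame I \<alpha> V \<kappa>"
    and H1: "\<And>s. s \<in> I \<Longrightarrow> (H 1 has_real_derivative \<kappa> 1 s * H 2 s) (at s)"
    and Hi: "\<And>i s. i \<in> {2..CARD('n) - 1} \<Longrightarrow> s \<in> I \<Longrightarrow>
      (H i has_real_derivative - \<kappa> (i - 1) s * H (i - 1) s + \<kappa> i s * H (Suc i) s) (at s)"
    and Hn: "\<And>s. s \<in> I \<Longrightarrow>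
      (H (CARD('n)) has_real_derivative - \<kappa> (CARD('n) - 1) s * H (CARD('n) - 1) s) (at s)"
  obtains c where "\<And>s i. s \<in> I \<Longrightarrow> i \<in> {1..CARD('n)} \<Longrightarrow> V i s \<bullet> c = H i s"
proof -
  let ?n = "CARD('n)"
  \<comment> \<open>With the curvatures of index 0 and \<open>n\<close> set to 0, all the Frenet equations have one form.\<close>
  define e where "e i s = (if i \<in> {1..<?n} then \<kappa> i s else 0)" for i s
  define W where "W s = (\<Sum>i=1..?n. H i s *\<^sub>R V i s)" for s
  have "(W has_vector_derivative 0) (at s within I)" if s: "s \<in> I" for s
  proof -
    have dH: "(H i has_real_derivative - e (i - 1) s * H (i - 1) s + e i s * H (Suc i) s) (at s)"
      and dV: "(V i has_vector_derivative
        (- e (i - 1) s) *\<^sub>R V (i - 1) s + e i s *\<^sub>R V (Suc i) s) (at s)"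
      if i: "i \<in> {1..?n}" for i
    proof -
      consider "i = 1" | "i = ?n" | "i \<in> {2..?n - 1}"
        using i by fastforce
      note cs = this
      have F: "(V 1 has_vector_derivative \<kappa> 1 s *\<^sub>R V 2 s) (at s)"
        "\<And>i. i \<in> {2..?n - 1} \<Longrightarrow> (V i has_vector_derivative
              (- \<kappa> (i - 1) s) *\<^sub>R V (i - 1) s + \<kappa> i s *\<^sub>R V (i + 1) s) (at s)"
        "(V ?n has_vector_derivative (- \<kappa> (?n - 1) s) *\<^sub>R V (?n - 1) s) (at s)"
        using frame s unfolding frenet_frame_def by blast+
      from cs show "(H i has_real_derivative
          - e (i - 1) s * H (i - 1) s + e i s * H (Suc i) s) (at s)"
      proof cases
        case 1
        then show ?thesis using H1[OF s] assms(2) by (simp add: e_def numeral_2_eq_2)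
      next
        case 2
        moreover have "e (?n - 1) s = \<kappa> (?n - 1) s" "e ?n s = 0"
          using assms(2) by (auto simp: e_def)
        ultimately show ?thesis using Hn[OF s] by simp
      next
        case 3
        moreover from 3 have "e (i - 1) s = \<kappa> (i - 1) s" "e i s = \<kappa> i s"
          by (auto simp: e_def)
        ultimately show ?thesis using Hi[OF 3 s] by simp
      qed
      from cs show "(V i has_vector_derivative
          (- e (i - 1) s) *\<^sub>R V (i - 1) s + e i s *\<^sub>R V (Suc i) s) (at s)"
      proof cases
        case 1
        then show ?thesis using F(1) assms(2) by (simp add: e_def numeral_2_eq_2)
      next
        case 2
        moreover have "e (?n - 1) s = \<kappa> (?n - 1) s" "e ?n s = 0"
          using assms(2) by (auto simp: e_def)
        ultimately show ?thesis using F(3) by simp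
      next
        case 3
        moreover from 3 have "e (i - 1) s = \<kappa> (i - 1) s" "e i s = \<kappa> i s"
          by (auto simp: e_def)
        ultimately show ?thesis using F(2)[OF 3] by simp
      qed
    qed
    \<comment> \<open>\<open>T i\<close> collects the terms with factor \<open>e i s\<close>, which
      couple the indices \<open>i\<close> and \<open>Suc i\<close>. The term with
      \<open>e (i - 1) s\<close> has the same shape one index lower, with opposite sign.\<close>
    define T where "T i = e i s *\<^sub>R (H i s *\<^sub>R V (Suc i) s + H (Suc i) s *\<^sub>R V i s)" for i
    have "((\<lambda>s. H i s *\<^sub>R V i s) has_vector_derivative T i - T (i - 1)) (at s)"
      if i: "i \<in> {1..?n}" for i
    proof -
      have "H i s *\<^sub>R ((- e (i - 1) s) *\<^sub>R V (i - 1) s + e i s *\<^sub>R V (Suc i) s) +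
          (- e (i - 1) s * H (i - 1) s + e i s * H (Suc i) s) *\<^sub>R V i s = T i - T (i - 1)"
        using i by (simp add: T_def algebra_simps)
      then show ?thesis
        using has_vector_derivative_scaleR[OF dH[OF i] dV[OF i]] by simp
    qed
    then have "(W has_vector_derivative (\<Sum>i=1..?n. T i - T (i - 1))) (at s)"
      unfolding W_def by (intro has_vector_derivative_sum)
    moreover have "(\<Sum>i=1..?n. T i - T (i - 1)) = T ?n - T 0"
      using sum_telescope''[of 0 ?n T] by simp
    \<comment> \<open>Both ends vanish because \<open>e 0 s\<close> and \<open>e ?n s\<close> are 0,
      so the unconstrained frame vectors of index 0 and \<open>?n + 1\<close> drop out.\<close>
    moreover have "T ?n - T 0 = 0" by (simp add: T_def e_def)
    ultimately show ?thesis by (simp add: has_vector_derivative_at_within)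
  qed
  then obtain c where c: "\<And>s. s \<in> I \<Longrightarrow> W s = c"
    using has_vector_derivative_zero_constant[OF \<open>convex I\<close>] by metis
  show thesis
  proof
    fix s i assume s: "s \<in> I" and i: "i \<in> {1..?n}"
    have "V i s \<bullet> W s = (\<Sum>j=1..?n. H j s * (V i s \<bullet> V j s))"
      by (simp add: W_def inner_sum_right)
    also have "\<dots> = (\<Sum>j=1..?n. if i = j then H j s else 0)"
      using frame s i by (intro sum.cong) (auto simp: frenet_frame_def)
    finally show "V i s \<bullet> c = H i s" using i c[OF s] by simp
  qed
qed

section \<open>The characterization of slant helices\<close>

text \<open>\<open>S\<close> and \<open>C\<close> depend on \<open>G1\<close> because their
  integrands contain \<open>slant_G \<kappa> G1\<close>. One choice for each \<open>G1\<close>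
  suffices: on an interval antiderivatives differ by constants, which \<open>A\<close> and
  \<open>B\<close> absorb.\<close>

theorem theorem3p2:
  fixes I :: "real set"
    and \<alpha> :: "real \<Rightarrow> real ^ 'n"
    and V :: "nat \<Rightarrow> real \<Rightarrow> real ^ 'n"
    and \<kappa> :: "nat \<Rightarrow> real \<Rightarrow> real"
    and \<phi> :: "real \<Rightarrow> real"
    and S C :: "(real \<Rightarrow> real) \<Rightarrow> real \<Rightarrow> real"
  defines "n \<equiv> CARD('n)"
  assumes "n \<ge> 3"
    and "open I" and "is_interval I" and "I \<noteq> {}"
    and "unit_speed_on I \<alpha>"
    and "frenet_frame I \<alpha> V \<kappa>"
    and "\<And>i. i \<in> {1..n - 1} \<Longrightarrow> smooth_on I (\<kappa> i)"
    and "\<And>i s. i \<in> {1..n - 1} \<Longrightarrow> s \<in> I \<Longrightarrow> \<kappa> i s \<noteq> 0"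
    and "antiderivative_on I \<phi> (\<kappa> (n - 1))"
    and "\<And>G1. antiderivative_on I G1 (\<kappa> 1) \<Longrightarrow>
           antiderivative_on I (S G1) (\<lambda>s. \<kappa> (n - 2) s * slant_G \<kappa> G1 (n - 2) s * sin (\<phi> s))"
    and "\<And>G1. antiderivative_on I G1 (\<kappa> 1) \<Longrightarrow>
           antiderivative_on I (C G1) (\<lambda>s. \<kappa> (n - 2) s * slant_G \<kappa> G1 (n - 2) s * cos (\<phi> s))"
  shows "(\<exists>\<theta>. cos \<theta> \<noteq> 0 \<and> slant_helix I \<alpha> V \<theta>) \<longleftrightarrow>
    (\<exists>G1. antiderivative_on I G1 (\<kappa> 1) \<and>
      (\<exists>A B. \<forall>s\<in>I. slant_G \<kappa> G1 (n - 1) s =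
         (A - S G1 s) * sin (\<phi> s) - (B + C G1 s) * cos (\<phi> s)))"
proof -
  have n3: "CARD('n) \<ge> 3" and I: "open I" "convex I"
    using assms(2-4) by (auto simp: n_def is_interval_convex)
  have nz: "\<And>i s. i \<in> {1..n - 1} \<Longrightarrow> s \<in> I \<Longrightarrow> \<kappa> i s \<noteq> 0" by fact
  have d\<phi>: "(\<phi> has_real_derivative \<kappa> (n - 1) s) (at s)" if "s \<in> I" for s
    using assms(10) that by (simp add: antiderivative_on_def)
  have dSC: "(S G has_real_derivative \<kappa> (n - 2) s * slant_G \<kappa> G (n - 2) s * sin (\<phi> s)) (at s)"
    "(C G has_real_derivative \<kappa> (n - 2) s * slant_G \<kappa> G (n - 2) s * cos (\<phi> s)) (at s)"
    if "antiderivative_on I G (\<kappa> 1)" "s \<in> I" for G s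
    using assms(11,12)[OF that(1)] that(2) by (auto simp: antiderivative_on_def)
  have F: "V i s \<bullet> V j s = (if i = j then 1 else 0)"
    "(V 1 has_vector_derivative \<kappa> 1 s *\<^sub>R V 2 s) (at s)"
    "k \<in> {2..n - 1} \<Longrightarrow> (V k has_vector_derivative
      (- \<kappa> (k - 1) s) *\<^sub>R V (k - 1) s + \<kappa> k s *\<^sub>R V (k + 1) s) (at s)"
    "(V n has_vector_derivative (- \<kappa> (n - 1) s) *\<^sub>R V (n - 1) s) (at s)"
    if "s \<in> I" "i \<in> {1..n}" "j \<in> {1..n}" for s i j k
    using \<open>frenet_frame I \<alpha> V \<kappa>\<close> that unfolding frenet_frame_def n_def by blast+
  \<comment> \<open>This discharges the index premises of \<open>F\<close> where only its derivative
    facts are wanted.\<close>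
  have n1: "1 \<in> {1..n}" using \<open>n \<ge> 3\<close> by simp
  show ?thesis
  proof
    assume "\<exists>\<theta>. cos \<theta> \<noteq> 0 \<and> slant_helix I \<alpha> V \<theta>"
    then obtain \<theta> U where \<theta>: "cos \<theta> \<noteq> 0" "\<And>s. s \<in> I \<Longrightarrow> V 2 s \<bullet> U = cos \<theta>"
      by (auto simp: slant_helix_def)
    \<comment> \<open>Dividing by \<open>cos \<theta>\<close>, which is nonzero, normalizes the
      second component of the axis to 1.\<close>
    define a where "a i s = V i s \<bullet> U / cos \<theta>" for i s
    have da: "(a i has_real_derivative v \<bullet> U / cos \<theta>) (at s)"
      if "(V i has_vector_derivative v) (at s)" for i v s
      using bounded_linear.has_vector_derivative[OF bounded_linear_inner_left that, of U]
      unfolding a_def by (intro DERIV_cdivide)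
        (simp add: has_real_derivative_iff_has_vector_derivative)
    have a2: "a 2 s = 1" if "s \<in> I" for s using that \<theta> by (simp add: a_def)
    \<comment> \<open>Since the second component is 1, the first equation makes \<open>a 1\<close>
      an antiderivative of \<open>\<kappa> 1\<close>; it is the witness for
      \<open>G1\<close>.\<close>
    have "(a 1 has_real_derivative \<kappa> 1 s) (at s)" if "s \<in> I" for s
      using da[OF F(2)[OF that n1 n1]] a2[OF that] by (simp add: a_def mult.assoc)
    then have anti: "antiderivative_on I (a 1) (\<kappa> 1)" by (simp add: antiderivative_on_def)
    have dai: "(a i has_real_derivative - \<kappa> (i - 1) s * a (i - 1) s + \<kappa> i s * a (Suc i) s) (at s)"
      if "i \<in> {2..<n}" "s \<in> I" for i s
      using da[OF F(3)[OF that(2) n1 n1, of i]] that(1)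
      by (auto simp: a_def inner_add_left inner_diff_left add_divide_distrib diff_divide_distrib)
    have dan: "(a n has_real_derivative - \<kappa> (n - 1) s * a (n - 1) s) (at s)" if "s \<in> I" for s
      using da[OF F(4)[OF that n1 n1]] by (simp add: a_def)
    have Ga: "slant_G \<kappa> (a 1) i s = a i s" if "i \<in> {1..n}" "s \<in> I" for i s
      by (rule slant_G_unique[OF I(1) a2 nz dai that]) auto
    \<comment> \<open>This is the first equation of the rotating system with
      \<open>x = a (n - 1)\<close>, \<open>y = a n\<close> and angular velocity
      \<open>\<kappa> (n - 1)\<close>; the forcing term is the factor in the integrands of
      \<open>S\<close> and \<open>C\<close>.\<close>
    have "(a (n - 1) has_real_derivative
        - (\<kappa> (n - 2) s * slant_G \<kappa> (a 1) (n - 2) s) + \<kappa> (n - 1) s * a n s) (at s)"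
      if "s \<in> I" for s
      using dai[of "n - 1" s] that Ga[of "n - 2" s] \<open>n \<ge> 3\<close>
      by (simp add: numeral_2_eq_2 Suc_diff_Suc)
    from rotating_system_solution[OF I(2) this dan d\<phi> dSC[OF anti]] obtain A B where
      "\<And>s. s \<in> I \<Longrightarrow> a (n - 1) s = (A - S (a 1) s) * sin (\<phi> s) - (B + C (a 1) s) * cos (\<phi> s)"
      by blast
    then have "\<forall>s\<in>I. slant_G \<kappa> (a 1) (n - 1) s =
        (A - S (a 1) s) * sin (\<phi> s) - (B + C (a 1) s) * cos (\<phi> s)"
      using Ga[of "n - 1"] \<open>n \<ge> 3\<close> by simp
    with anti show "\<exists>G1. antiderivative_on I G1 (\<kappa> 1) \<and>
      (\<exists>A B. \<forall>s\<in>I. slant_G \<kappa> G1 (n - 1) s =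
         (A - S G1 s) * sin (\<phi> s) - (B + C G1 s) * cos (\<phi> s))" by blast
  next
    assume "\<exists>G1. antiderivative_on I G1 (\<kappa> 1) \<and>
      (\<exists>A B. \<forall>s\<in>I. slant_G \<kappa> G1 (n - 1) s =
         (A - S G1 s) * sin (\<phi> s) - (B + C G1 s) * cos (\<phi> s))"
    then obtain G A B where anti: "antiderivative_on I G (\<kappa> 1)"
      and GAB: "\<And>s. s \<in> I \<Longrightarrow> slant_G \<kappa> G (n - 1) s =
         (A - S G s) * sin (\<phi> s) - (B + C G s) * cos (\<phi> s)"
      by blast
    \<comment> \<open>The integral condition gives one coordinate of the rotating system;
      \<open>y\<close> is the other one for the same \<open>A\<close> and \<open>B\<close>. It
      becomes the last component in \<open>H\<close>, differentiable directly from \<open>S\<close>,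
      \<open>C\<close> and \<open>\<phi>\<close>.\<close>
    define y where "y s = (A - S G s) * cos (\<phi> s) + (B + C G s) * sin (\<phi> s)" for s
    define H where "H i = (if i < n then slant_G \<kappa> G i else y)" for i
    have \<kappa>_diff: "diff_times k I (\<kappa> i)" if "i \<in> {1..n - 1}" for i k
      using smooth_on_imp_diff_times I(1) assms(8) that by blast
    have dG: "(G has_real_derivative \<kappa> 1 s) (at s)" if "s \<in> I" for s
      using anti that by (simp add: antiderivative_on_def)
    have "diff_times k I G" for k
    proof (rule diff_times_Suc_imp)
      have "diff_times k I (\<kappa> 1)" using \<kappa>_diff \<open>n \<ge> 3\<close> by simp
      with dG show "diff_times (Suc k) I G" by auto
    qed
    then have G_diff: "diff_times k I (slant_G \<kappa> G i)" if "i < n" for i k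
      using that by (intro diff_times_slant_G I(1) \<kappa>_diff nz) auto
    have H1: "(H 1 has_real_derivative \<kappa> 1 s * H 2 s) (at s)" if "s \<in> I" for s
      using dG[OF that] \<open>n \<ge> 3\<close> by (simp add: H_def numeral_2_eq_2)
    have Hi: "(H i has_real_derivative
        - \<kappa> (i - 1) s * H (i - 1) s + \<kappa> i s * H (Suc i) s) (at s)"
      if i: "i \<in> {2..n - 1}" and s: "s \<in> I" for i s
    \<comment> \<open>For \<open>i = n - 1\<close> the equation comes from differentiating the
      integral condition, for smaller \<open>i\<close> from the recursion.\<close>
    proof (cases "i = n - 1")
      case True
      have idx: "i - 1 = n - 2" "Suc i = n" "n - 2 < n" using True \<open>n \<ge> 3\<close> by auto
      \<comment> \<open>Differentiating \<open>S\<close> and \<open>C\<close> produces the forcing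
        term times the squares of sine and cosine; these two terms are merged here.\<close>
      have sq: "f * sin u * sin u + f * cos u * cos u = f" for f u :: real
        using sin_cos_squared_add[of u]
        by (metis distrib_left mult.assoc mult.right_neutral power2_eq_square)
      have "((\<lambda>s. (A - S G s) * sin (\<phi> s) - (B + C G s) * cos (\<phi> s)) has_real_derivative
          - \<kappa> (n - 2) s * slant_G \<kappa> G (n - 2) s + \<kappa> (n - 1) s * y s) (at s)"
        by (rule derivative_eq_intros refl d\<phi> dSC anti s)+
          (use sq[of "\<kappa> (n - 2) s * slant_G \<kappa> G (n - 2) s" "\<phi> s"] in
            \<open>simp add: y_def algebra_simps\<close>)
      then have "(slant_G \<kappa> G (n - 1) has_real_derivative
          - \<kappa> (n - 2) s * slant_G \<kappa> G (n - 2) s + \<kappa> (n - 1) s * y s) (at s)"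
        by (rule has_field_derivative_transform_within_open[OF _ I(1) s]) (simp only: GAB)
      then show ?thesis using idx True by (simp add: H_def)
    next
      case False
      then have idx: "i < n" "Suc i < n" "i - 1 < n" "i \<ge> 2" using i by auto
      obtain D where "(slant_G \<kappa> G i has_real_derivative D) (at s)"
        using G_diff[OF idx(1), of "Suc 0"] s by auto
      from slant_G_has_derivative[OF idx(4) _ this] show ?thesis
        using idx nz[of i s] i s by (simp add: H_def)
    qed
    have Hn: "(H n has_real_derivative - \<kappa> (n - 1) s * H (n - 1) s) (at s)" if s: "s \<in> I" for s
    proof -
      have "(y has_real_derivative
          - \<kappa> (n - 1) s * ((A - S G s) * sin (\<phi> s) - (B + C G s) * cos (\<phi> s))) (at s)"
        unfolding y_def
        by (rule derivative_eq_intros refl d\<phi> dSC anti s)+ (simp add: algebra_simps)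
      then show ?thesis using GAB[OF s] \<open>n \<ge> 3\<close> by (simp add: H_def)
    qed
    obtain c where c: "\<And>s i. s \<in> I \<Longrightarrow> i \<in> {1..n} \<Longrightarrow> V i s \<bullet> c = H i s"
      using frenet_frame_axis[OF I(2) n3 \<open>frenet_frame I \<alpha> V \<kappa>\<close> H1 Hi[unfolded n_def]
          Hn[unfolded n_def]] unfolding n_def by blast
    have c2: "V 2 s \<bullet> c = 1" if "s \<in> I" for s
      using c[OF that, of 2] \<open>n \<ge> 3\<close> by (simp add: H_def numeral_2_eq_2)
    \<comment> \<open>Cauchy-Schwarz at a single point of \<open>I\<close> gives
      \<open>norm c \<ge> 1\<close>. Hence \<open>c\<close> can be normalized, and
      \<open>1 / norm c\<close> is the nonzero cosine of an angle.\<close>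
    obtain s0 where s0: "s0 \<in> I" using \<open>I \<noteq> {}\<close> by blast
    have "norm (V 2 s0) = 1"
      using F(1)[OF s0, of 2 2] \<open>n \<ge> 3\<close> by (simp add: norm_eq_sqrt_inner)
    then have c1: "norm c \<ge> 1"
      using c2[OF s0] Cauchy_Schwarz_ineq2[of "V 2 s0" c] by simp
    define \<theta> where "\<theta> = arccos (1 / norm c)"
    have "- 1 \<le> 1 / norm c"
      by (rule order_trans[of _ 0]) auto
    moreover have "1 / norm c \<le> 1"
      using c1 by (intro divide_le_eq_1_pos[THEN iffD2]) auto
    ultimately have \<theta>: "cos \<theta> = 1 / norm c" by (simp add: \<theta>_def)
    have "c \<noteq> 0" using c1 by auto
    then have "(c /\<^sub>R norm c) \<bullet> (c /\<^sub>R norm c) = 1"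
      by (simp add: dot_square_norm power2_eq_square)
    moreover have "\<forall>s\<in>I. V 2 s \<bullet> (c /\<^sub>R norm c) = cos \<theta>"
      using c2 \<theta> by (simp add: divide_inverse)
    ultimately have "slant_helix I \<alpha> V \<theta>"
      unfolding slant_helix_def using \<open>unit_speed_on I \<alpha>\<close> by blast
    moreover have "cos \<theta> \<noteq> 0" using \<theta> c1 by auto
    ultimately show "\<exists>\<theta>. cos \<theta> \<noteq> 0 \<and> slant_helix I \<alpha> V \<theta>" by blast
  qed
qed

end
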